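(* Let $G$ be a finite simple connected graph of order $n$ with clique number $\omega$. Then \[\sqrt{s^+(G)} \le n\sqrt{1-\frac{1}{\omega}-\frac{1}{\omega^2}}\,.\]
   Context: For a graph $G$ with adjacency eigenvalues $\lambda_1\ge\cdots\ge\lambda_n$, the positive square energy is $s^+(G)=\sum_{\lambda_i>0}\lambda_i^2$.
   Formalization: The formal statement assumes n ≥ 2; for the one-vertex graph (ω = 1) the radicand 1 − 1/ω − 1/ω² equals −1, so the right-hand side is undefined, and no other connected graph is excluded. *)

theory Defs
  imports
    "Graph_Theory.Digraph_Component"
    "Jordan_Normal_Form.Char_Poly"
    "HOL-Library.Multiset"
begin

text \<open>Finite simple graphs are those of \<^locale>\<open>pair_graph\<close>: finite, loop-free, and with a
  symmetric set of arcs, an edge \<open>uv\<close> being the two arcs \<open>(u, v)\<close> and \<open>(v, u)\<close>.\<close>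

definition adjacency_matrix :: "'a pair_pre_digraph \<Rightarrow> 'a list \<Rightarrow> real mat" where
  "adjacency_matrix G vs =
     mat (length vs) (length vs) (\<lambda>(i, j). if (vs ! i, vs ! j) \<in> parcs G then 1 else 0)"

text \<open>The eigenvalues counted with multiplicity. The choice of the vertex enumeration is
  immaterial, see \<open>adjacency_eigenvalues_eq\<close> below. As the matrix is real and symmetric, the
  real roots of its characteristic polynomial are all the roots.\<close>

definition adjacency_eigenvalues :: "'a pair_pre_digraph \<Rightarrow> real multiset" where
  "adjacency_eigenvalues G =
     proots (char_poly (adjacency_matrix G (SOME vs. distinct vs \<and> set vs = pverts G)))"

definition positive_square_energy :: "'a pair_pre_digraph \<Rightarrow> real" where
  "positive_square_energy G = (\<Sum>x\<in>#filter_mset (\<lambda>x. x > 0) (adjacency_eigenvalues G). x\<^sup>2)"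

definition is_clique :: "'a pair_pre_digraph \<Rightarrow> 'a set \<Rightarrow> bool" where
  "is_clique G C \<longleftrightarrow> C \<subseteq> pverts G \<and> (\<forall>u\<in>C. \<forall>v\<in>C. u \<noteq> v \<longrightarrow> (u, v) \<in> parcs G)"

definition clique_number :: "'a pair_pre_digraph \<Rightarrow> nat" where
  "clique_number G = Max (card ` {C. is_clique G C})"

lemma similar_adjacency_matrix:
  assumes vs: "distinct vs" "set vs = V" and ws: "distinct ws" "set ws = V"
  shows "similar_mat (adjacency_matrix G vs) (adjacency_matrix G ws)"
proof -
  let ?n = "length vs"
  have len: "length ws = ?n"
    using vs ws distinct_card by metis
  define P :: "real mat" where "P = mat ?n ?n (\<lambda>(i, k). if vs ! i = ws ! k then 1 else 0)"
  define Q :: "real mat" where "Q = mat ?n ?n (\<lambda>(k, i). if vs ! i = ws ! k then 1 else 0)"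
  have ex_w: "\<exists>k<?n. ws ! k = vs ! i" if "i < ?n" for i
    using that vs ws len by (metis in_set_conv_nth nth_mem)
  have ex_v: "\<exists>i<?n. vs ! i = ws ! k" if "k < ?n" for k
    using that vs ws len by (metis in_set_conv_nth nth_mem)
  have inj_w: "ws ! k = ws ! l \<longleftrightarrow> k = l" if "k < ?n" "l < ?n" for k l
    using that ws len by (simp add: nth_eq_iff_index_eq)
  have inj_v: "vs ! k = vs ! l \<longleftrightarrow> k = l" if "k < ?n" "l < ?n" for k l
    using that vs by (simp add: nth_eq_iff_index_eq)
  have sum_w: "(\<Sum>k = 0..<?n. (if x = ws ! k then 1 else 0) * f k) = f l"
    if "l < ?n" "x = ws ! l" for x l and f :: "nat \<Rightarrow> real"
  proof -
    have "(\<Sum>k = 0..<?n. (if x = ws ! k then 1 else 0) * f k)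
        = (\<Sum>k = 0..<?n. if k = l then f k else 0)"
      using that inj_w by (intro sum.cong) auto
    then show ?thesis using that by simp
  qed
  have sum_v: "(\<Sum>k = 0..<?n. (if vs ! k = x then 1 else 0) * f k) = f l"
    if "l < ?n" "x = vs ! l" for x l and f :: "nat \<Rightarrow> real"
  proof -
    have "(\<Sum>k = 0..<?n. (if vs ! k = x then 1 else 0) * f k)
        = (\<Sum>k = 0..<?n. if k = l then f k else 0)"
      using that inj_v by (intro sum.cong) auto
    then show ?thesis using that by simp
  qed
  have dims: "P \<in> carrier_mat ?n ?n" "Q \<in> carrier_mat ?n ?n"
    "adjacency_matrix G vs \<in> carrier_mat ?n ?n" "adjacency_matrix G ws \<in> carrier_mat ?n ?n"
    by (auto simp: P_def Q_def adjacency_matrix_def len)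
  have PQ: "P * Q = 1\<^sub>m ?n"
  proof (rule eq_matI)
    fix i j assume "i < dim_row (1\<^sub>m ?n :: real mat)" "j < dim_col (1\<^sub>m ?n :: real mat)"
    then have ij: "i < ?n" "j < ?n" by auto
    obtain l where l: "l < ?n" "vs ! i = ws ! l" using ex_w[OF ij(1)] by metis
    show "(P * Q) $$ (i, j) = 1\<^sub>m ?n $$ (i, j)"
      using ij sum_w[OF l, of "\<lambda>k. if vs ! j = ws ! k then 1 else 0"] l inj_v[OF ij]
      by (auto simp: P_def Q_def scalar_prod_def)
  qed (auto simp: P_def Q_def)
  have QP: "Q * P = 1\<^sub>m ?n"
  proof (rule eq_matI)
    fix i j assume "i < dim_row (1\<^sub>m ?n :: real mat)" "j < dim_col (1\<^sub>m ?n :: real mat)"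
    then have ij: "i < ?n" "j < ?n" by auto
    obtain l where l: "l < ?n" "ws ! i = vs ! l" using ex_v[OF ij(1)] by metis
    show "(Q * P) $$ (i, j) = 1\<^sub>m ?n $$ (i, j)"
      using ij sum_v[OF l, of "\<lambda>k. if vs ! k = ws ! j then 1 else 0"] l inj_w[OF ij]
      by (auto simp: P_def Q_def scalar_prod_def)
  qed (auto simp: P_def Q_def)
  have AP: "adjacency_matrix G vs * P = P * adjacency_matrix G ws"
  proof (rule eq_matI)
    fix i j
    assume "i < dim_row (P * adjacency_matrix G ws)" "j < dim_col (P * adjacency_matrix G ws)"
    then have ij: "i < ?n" "j < ?n" using dims by auto
    obtain l where l: "l < ?n" "vs ! i = ws ! l" using ex_w[OF ij(1)] by metis
    obtain m where m: "m < ?n" "ws ! j = vs ! m" using ex_v[OF ij(2)] by metis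
    have "(adjacency_matrix G vs * P) $$ (i, j) = (if (vs ! i, vs ! m) \<in> parcs G then 1 else 0)"
      using ij sum_v[OF m, of "\<lambda>k. if (vs ! i, vs ! k) \<in> parcs G then 1 else 0"]
      by (simp add: P_def adjacency_matrix_def scalar_prod_def mult.commute)
    moreover have "(P * adjacency_matrix G ws) $$ (i, j)
        = (if (ws ! l, ws ! j) \<in> parcs G then 1 else 0)"
      using ij sum_w[OF l, of "\<lambda>k. if (ws ! k, ws ! j) \<in> parcs G then 1 else 0"]
      by (simp add: P_def adjacency_matrix_def scalar_prod_def len)
    ultimately show "(adjacency_matrix G vs * P) $$ (i, j) = (P * adjacency_matrix G ws) $$ (i, j)"
      using l m by simp
  qed (use dims in auto)
  have "adjacency_matrix G vs = adjacency_matrix G vs * (P * Q)"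
    using PQ dims by simp
  also have "\<dots> = adjacency_matrix G vs * P * Q"
    using dims by (simp add: assoc_mult_mat[of _ ?n ?n _ ?n _ ?n])
  also have "\<dots> = P * adjacency_matrix G ws * Q"
    by (simp add: AP)
  finally show ?thesis
    using dims PQ QP by (intro similar_matI[where n = ?n and P = P and Q = Q]) auto
qed

lemma adjacency_eigenvalues_eq:
  assumes "distinct vs" "set vs = pverts G"
  shows "adjacency_eigenvalues G = proots (char_poly (adjacency_matrix G vs))"
proof -
  let ?ws = "SOME vs. distinct vs \<and> set vs = pverts G"
  have "distinct ?ws \<and> set ?ws = pverts G"
    using assms by (intro someI_ex[of "\<lambda>vs. distinct vs \<and> set vs = pverts G"]) blast
  then have "similar_mat (adjacency_matrix G ?ws) (adjacency_matrix G vs)"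
    using assms by (intro similar_adjacency_matrix) auto
  then show ?thesis
    unfolding adjacency_eigenvalues_def by (metis char_poly_similar)
qed

end

theory Submission
  imports Defs "Jordan_Normal_Form.Spectral_Radius"
begin

text \<open>Let \<open>\<rho>\<close> be the largest eigenvalue of the adjacency matrix \<open>A\<close>, let \<open>s\<^sup>-\<close> be the sum of the squares
  of the negative eigenvalues, and let \<open>2m\<close> be the sum of the degrees, so that \<open>s\<^sup>+ = 2m - s\<^sup>-\<close>. As
  \<open>A\<close> has nonnegative entries, every eigenvalue is at most \<open>\<rho>\<close> in absolute value. Comparing the
  cubes of the eigenvalues therefore gives \<open>\<rho> s\<^sup>- \<ge> \<rho>\<^sup>3 - tr A\<^sup>3\<close>. Neighbourhoods contain no clique on
  \<open>\<omega>\<close> vertices, so Turan's theorem inside each neighbourhood bounds \<open>tr A\<^sup>3\<close> by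
  \<open>(1 - 1/(\<omega> - 1)) \<Sum>d(v)\<^sup>2 \<le> (1 - 1/(\<omega> - 1)) \<rho>\<^sup>2 n\<close>. Hence
  \<open>s\<^sup>+ \<le> 2m - \<rho>\<^sup>2 + (1 - 1/(\<omega> - 1)) \<rho> n\<close>, and inserting \<open>2m \<le> \<rho> n\<close> or Turan's bound
  \<open>2m \<le> (1 - 1/\<omega>) n\<^sup>2\<close>, according to whether \<open>\<rho> \<le> (1 - 1/\<omega>) n\<close>, finishes the proof.\<close>

section \<open>Spectral theorem for real symmetric matrices\<close>

text \<open>Over the complex numbers an eigenvector \<open>v\<close> exists. As \<open>A\<close> is
  real and symmetric, the form v* A v is real; it equals \<open>e\<close> times the squared norm of
  \<open>v\<close>, so \<open>e\<close> is real.\<close>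

lemma symmetric_mat_has_real_eigenvalue:
  fixes A :: "real mat"
  assumes A: "A \<in> carrier_mat n n" and sym: "transpose_mat A = A" and n: "n > 0"
  shows "\<exists>e. eigenvalue A e"
proof -
  let ?C = "map_mat complex_of_real A"
  have C: "?C \<in> carrier_mat n n" using A by simp
  obtain e where e: "eigenvalue ?C e"
    using spectrum_non_empty[OF C n] by (auto simp: spectrum_def)
  then obtain v where "eigenvector ?C v e" by (auto simp: eigenvalue_def)
  then have v: "v \<in> carrier_vec n" "v \<noteq> 0\<^sub>v n" "?C *\<^sub>v v = e \<cdot>\<^sub>v v"
    using C A by (auto simp: eigenvector_def)
  have entry: "(\<Sum>j<n. of_real (A $$ (i, j)) * v $ j) = e * v $ i" if "i < n" for i
    using arg_cong[OF v(3), of "\<lambda>w. w $ i"] that v(1) A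
    by (simp add: scalar_prod_def atLeast0LessThan)
  have symA: "A $$ (i, j) = A $$ (j, i)" if "i < n" "j < n" for i j
    using arg_cong[OF sym, of "\<lambda>M. M $$ (i, j)"] that A by simp
  define q where "q = (\<Sum>i<n. \<Sum>j<n. cnj (v $ i) * of_real (A $$ (i, j)) * v $ j)"
  have "cnj q = (\<Sum>i<n. \<Sum>j<n. v $ i * of_real (A $$ (i, j)) * cnj (v $ j))"
    by (simp add: q_def)
  also have "\<dots> = (\<Sum>j<n. \<Sum>i<n. v $ i * of_real (A $$ (i, j)) * cnj (v $ j))"
    by (rule sum.swap)
  also have "\<dots> = q"
    unfolding q_def by (intro sum.cong refl) (simp add: symA)
  finally have q_real: "cnj q = q" .
  define s where "s = (\<Sum>i<n. (cmod (v $ i))\<^sup>2)"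
  have "q = (\<Sum>i<n. cnj (v $ i) * (e * v $ i))"
    unfolding q_def using entry by (simp add: sum_distrib_left[symmetric] mult.assoc)
  also have "\<dots> = e * of_real s"
    by (simp add: s_def sum_distrib_left complex_norm_square mult_ac del: of_real_power)
  finally have q: "q = e * of_real s" .
  obtain k where k: "k < n" "v $ k \<noteq> 0" using v(1,2) by force
  have "s > 0"
    unfolding s_def by (rule sum_pos2[of _ k]) (use k in auto)
  then have "cnj e = e" using q_real q by auto
  then have "e = of_real (Re e)" by (metis Reals_cnj_iff of_real_Re)
  \<comment> \<open>The characteristic polynomial of \<open>?C\<close> is that of \<open>A\<close>
    with its coefficients embedded, so a real root descends to \<open>A\<close>.\<close>
  then have "poly (map_poly of_real (char_poly A)) (of_real (Re e) :: complex) = 0"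
    using e eigenvalue_root_char_poly[OF C] of_real_hom.char_poly_hom[OF A] by metis
  then have "poly (char_poly A) (Re e) = 0"
    by (metis of_real_hom.poly_map_poly of_real_eq_0_iff)
  then show ?thesis using eigenvalue_root_char_poly[OF A] by blast
qed

text \<open>The Householder reflection exchanging \<open>v\<close> and the first unit vector.\<close>

lemma exists_symmetric_involution_with_first_col:
  fixes v :: "real vec"
  assumes v: "v \<in> carrier_vec n" and n: "n > 0" and unit: "(\<Sum>i<n. (v $ i)\<^sup>2) = 1"
  shows "\<exists>W\<in>carrier_mat n n. transpose_mat W = W \<and> W * W = 1\<^sub>m n \<and> col W 0 = v"
proof (cases "v $ 0 = 1")
  case True
  \<comment> \<open>The reflection below divides by \<open>1 - v $ 0\<close>, hence this separate
    case; the unit norm forces \<open>v\<close> to be the first unit vector.\<close>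
  have "{..<n} = insert 0 {1..<n}" using n by auto
  then have "(\<Sum>i\<in>{1..<n}. (v $ i)\<^sup>2) = 0" using unit True by simp
  then have "v $ i = 0" if "i < n" "i \<noteq> 0" for i
    using that by (auto simp: sum_nonneg_eq_0_iff)
  then have "col (1\<^sub>m n) 0 = v" using v n True by (intro eq_vecI) (auto simp: unit_vec_def)
  then show ?thesis by (intro bexI[of _ "1\<^sub>m n"]) auto
next
  case False
  \<comment> \<open>\<open>w\<close> is the normal of the mirror. Since \<open>c\<close> is half its
    squared norm, \<open>W\<close> below is the usual I - 2 w w^T / |w|^2.\<close>
  define w where "w i = v $ i - (if i = 0 then 1 else 0)" for i
  define c where "c = 1 - v $ 0"
  have c: "c \<noteq> 0" using False by (simp add: c_def)
  define W where "W = mat n n (\<lambda>(i, j). (if i = j then 1 else 0) - w i * w j / c)"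
  have "(\<Sum>i<n. (w i)\<^sup>2) = (\<Sum>i<n. (v $ i)\<^sup>2 + (if i = 0 then 1 - 2 * v $ 0 else 0))"
    by (intro sum.cong) (auto simp: w_def power2_eq_square algebra_simps)
  also have "\<dots> = 2 * c"
    using n unit by (simp add: sum.distrib c_def)
  finally have ww: "(\<Sum>i<n. (w i)\<^sup>2) = 2 * c" .
  have "W * W = 1\<^sub>m n"
  proof (rule eq_matI)
    fix i j assume "i < dim_row (1\<^sub>m n :: real mat)" "j < dim_col (1\<^sub>m n :: real mat)"
    then have ij: "i < n" "j < n" by auto
    have "(W * W) $$ (i, j) = (\<Sum>k<n. ((if i = k then 1 else 0) - w i * w k / c) *
        ((if k = j then 1 else 0) - w k * w j / c))"
      using ij by (simp add: W_def scalar_prod_def atLeast0LessThan)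
    also have "\<dots> = (\<Sum>k<n. (if k = i then (if i = j then 1 else 0) - w i * w j / c else 0)
        + (if k = j then - (w i * w j / c) else 0) + w i * w j / c\<^sup>2 * (w k)\<^sup>2)"
      by (intro sum.cong refl) (auto simp: power2_eq_square algebra_simps)
    also have "\<dots> = (if i = j then 1 else 0) - 2 * (w i * w j / c) + w i * w j / c\<^sup>2 * (2 * c)"
      unfolding sum.distrib sum_distrib_left[symmetric] ww using ij by (simp add: sum.delta)
    also have "\<dots> = (if i = j then 1 else 0)" using c by (simp add: power2_eq_square)
    finally show "(W * W) $$ (i, j) = 1\<^sub>m n $$ (i, j)" using ij by simp
  qed (auto simp: W_def)
  moreover have "col W 0 = v"
    using v n c by (intro eq_vecI) (auto simp: W_def w_def c_def field_simps)
  moreover have "transpose_mat W = W" by (rule eq_matI) (auto simp: W_def mult.commute)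
  ultimately show ?thesis by (intro bexI[of _ W]) (auto simp: W_def)
qed

text \<open>Deflation: a reflection moves a unit eigenvector to the first unit vector. This clears
  the first column below the diagonal, symmetry clears the first row, and induction handles the
  remaining block.\<close>

theorem symmetric_mat_orthogonal_diagonalization:
  fixes A :: "real mat"
  assumes "A \<in> carrier_mat n n" "transpose_mat A = A"
  shows "\<exists>P d. P \<in> carrier_mat n n \<and> transpose_mat P * P = 1\<^sub>m n \<and>
    transpose_mat P * A * P = mat_diag n d"
  using assms
proof (induction n arbitrary: A)
  case 0
  then show ?case by (intro exI[of _ "1\<^sub>m 0"] exI[of _ "\<lambda>_. 0"]) (auto intro!: eq_matI simp: mat_diag_def)
next
  case (Suc n)
  note A = Suc.prems(1) and sym = Suc.prems(2)
  obtain e u where "eigenvector A u e"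
    using symmetric_mat_has_real_eigenvalue[OF A sym] by (auto simp: eigenvalue_def)
  then have u: "u \<in> carrier_vec (Suc n)" "u \<noteq> 0\<^sub>v (Suc n)" "A *\<^sub>v u = e \<cdot>\<^sub>v u"
    using A by (auto simp: eigenvector_def)
  define s where "s = (\<Sum>i<Suc n. (u $ i)\<^sup>2)"
  obtain k where k: "k < Suc n" "u $ k \<noteq> 0" using u(1,2) by force
  have s: "s > 0" unfolding s_def by (rule sum_pos2[of _ k]) (use k in auto)
  define v where "v = (1 / sqrt s) \<cdot>\<^sub>v u"
  have v: "v \<in> carrier_vec (Suc n)" using u by (simp add: v_def)
  have Av: "A *\<^sub>v v = e \<cdot>\<^sub>v v"
    using u A by (simp add: v_def mult_mat_vec smult_smult_assoc mult.commute)
  have "(\<Sum>i<Suc n. (v $ i)\<^sup>2) = (\<Sum>i<Suc n. (u $ i)\<^sup>2 / s)"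
    using u(1) s by (intro sum.cong) (auto simp: v_def power_divide)
  also have "\<dots> = 1" using s by (simp only: sum_divide_distrib[symmetric] s_def[symmetric]) simp
  finally obtain W where W: "W \<in> carrier_mat (Suc n) (Suc n)" "transpose_mat W = W"
      "W * W = 1\<^sub>m (Suc n)" "col W 0 = v"
    using exists_symmetric_involution_with_first_col[OF v] by auto
  define A' where "A' = W * A * W"
  have A': "A' \<in> carrier_mat (Suc n) (Suc n)" using W A by (simp add: A'_def)
  have symA': "transpose_mat A' = A'"
    using W A sym
    by (simp add: A'_def transpose_mult[of _ "Suc n" "Suc n" _ "Suc n"]
        assoc_mult_mat[of _ "Suc n" "Suc n" _ "Suc n" _ "Suc n"])
  \<comment> \<open>The first column of \<open>A'\<close> is W A v = e W v. Since \<open>v\<close>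
    is the first column of the involution \<open>W\<close>, W v is the first unit vector.\<close>
  have "col A' 0 = (W * A) *\<^sub>v v"
    unfolding A'_def using W A by (subst col_mult2[of _ "Suc n" "Suc n" _ "Suc n"]) auto
  also have "\<dots> = W *\<^sub>v (A *\<^sub>v v)"
    using W A v by (simp add: assoc_mult_mat_vec)
  also have "\<dots> = e \<cdot>\<^sub>v (W *\<^sub>v col W 0)"
    using W v by (simp add: Av mult_mat_vec)
  also have "W *\<^sub>v col W 0 = col (W * W) 0"
    using W by (subst col_mult2[of _ "Suc n" "Suc n" _ "Suc n"]) auto
  also have "\<dots> = unit_vec (Suc n) 0" using W by simp
  finally have col0: "col A' 0 = e \<cdot>\<^sub>v unit_vec (Suc n) 0" .
  have A'_col: "A' $$ (i, 0) = (if i = 0 then e else 0)" if "i < Suc n" for i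
    using arg_cong[OF col0, of "\<lambda>x. x $ i"] that A' by (simp add: unit_vec_def)
  have A'_row: "A' $$ (0, i) = (if i = 0 then e else 0)" if "i < Suc n" for i
    using arg_cong[OF symA', of "\<lambda>M. M $$ (i, 0)"] that A' A'_col[OF that] by simp
  define B where "B = mat n n (\<lambda>(i, j). A' $$ (Suc i, Suc j))"
  have B: "B \<in> carrier_mat n n" by (simp add: B_def)
  define E where "E = mat 1 1 (\<lambda>_. e)"
  have A'_block: "A' = four_block_mat E (0\<^sub>m 1 n) (0\<^sub>m n 1) B"
    by (rule eq_matI) (use A' A'_col A'_row in \<open>auto simp: E_def B_def\<close>)
  have "transpose_mat B = B"
  proof (rule eq_matI)
    fix i j assume "i < dim_row B" "j < dim_col B"
    then show "transpose_mat B $$ (i, j) = B $$ (i, j)"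
      using arg_cong[OF symA', of "\<lambda>M. M $$ (Suc i, Suc j)"] A' by (simp add: B_def)
  qed (auto simp: B_def)
  from Suc.IH[OF B this] obtain P d where P: "P \<in> carrier_mat n n"
      "transpose_mat P * P = 1\<^sub>m n" "transpose_mat P * B * P = mat_diag n d" by blast
  \<comment> \<open>Bordering \<open>P\<close> with a 1 makes conjugation by \<open>R\<close> keep
    the entry \<open>e\<close> while diagonalizing \<open>B\<close>.\<close>
  define R where "R = four_block_mat (1\<^sub>m 1) (0\<^sub>m 1 n) (0\<^sub>m n 1) P"
  have R: "R \<in> carrier_mat (Suc n) (Suc n)"
    using P four_block_carrier_mat[of "1\<^sub>m 1" 1 1 P n n] by (auto simp: R_def)
  have Rt: "transpose_mat R = four_block_mat (1\<^sub>m 1) (0\<^sub>m 1 n) (0\<^sub>m n 1) (transpose_mat P)"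
    using P unfolding R_def by (subst transpose_four_block_mat[of _ 1 1 _ n _ n]) auto
  have E: "E \<in> carrier_mat 1 1" by (simp add: E_def)
  have RR: "transpose_mat R * R = 1\<^sub>m (Suc n)"
    unfolding Rt unfolding R_def using P
    by (subst mult_four_block_mat[of _ 1 1 _ n _ n _ _ 1 _ n]) (auto intro!: eq_matI simp: mat_diag_def)
  have "transpose_mat R * A' = four_block_mat E (0\<^sub>m 1 n) (0\<^sub>m n 1) (transpose_mat P * B)"
    unfolding Rt A'_block using P B E
    by (subst mult_four_block_mat[of _ 1 1 _ n _ n _ _ 1 _ n]) auto
  then have "transpose_mat R * A' * R = four_block_mat E (0\<^sub>m 1 n) (0\<^sub>m n 1) (mat_diag n d)"
    using P B E unfolding R_def
    by (simp, subst mult_four_block_mat[of _ 1 1 _ n _ n _ _ 1 _ n]) auto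
  also have "\<dots> = mat_diag (Suc n) (\<lambda>i. case i of 0 \<Rightarrow> e | Suc j \<Rightarrow> d j)"
    by (rule eq_matI) (auto simp: E_def mat_diag_def split: nat.split)
  finally have RAR: "transpose_mat R * A' * R = mat_diag (Suc n) (\<lambda>i. case i of 0 \<Rightarrow> e | Suc j \<Rightarrow> d j)" .
  define Q where "Q = W * R"
  have Q: "Q \<in> carrier_mat (Suc n) (Suc n)" using W R by (simp add: Q_def)
  have Qt: "transpose_mat Q = transpose_mat R * W"
    using W R by (simp add: Q_def transpose_mult[of _ "Suc n" "Suc n" _ "Suc n"])
  have Rt': "transpose_mat R \<in> carrier_mat (Suc n) (Suc n)" using R by simp
  note assoc = assoc_mult_mat[of _ "Suc n" "Suc n" _ "Suc n" _ "Suc n"]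
  have "transpose_mat Q * Q = transpose_mat R * (W * W) * R"
    unfolding Qt unfolding Q_def using W(1) R Rt' by (simp add: assoc)
  also have "\<dots> = 1\<^sub>m (Suc n)" using W(3) RR Rt' by simp
  finally have QQ: "transpose_mat Q * Q = 1\<^sub>m (Suc n)" .
  have "transpose_mat Q * A * Q = transpose_mat R * A' * R"
    unfolding Qt unfolding Q_def A'_def using W(1) R Rt' A by (simp add: assoc)
  with RAR Q QQ show ?case by (intro exI conjI) auto
qed

text \<open>The vectors \<open>u k\<close> are the columns of the diagonalizing matrix P. The second
  property is completeness, from P P^T = I, which is the form that yields expansions in the
  basis.\<close>

lemma symmetric_eigenbasis:
  fixes a :: "nat \<Rightarrow> nat \<Rightarrow> real"
  assumes sym: "\<And>i j. i < n \<Longrightarrow> j < n \<Longrightarrow> a i j = a j i"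
  obtains u :: "nat \<Rightarrow> nat \<Rightarrow> real" and l :: "nat \<Rightarrow> real"
  where "\<And>k. k < n \<Longrightarrow> (\<Sum>i<n. (u k i)\<^sup>2) = 1"
    and "\<And>i j. i < n \<Longrightarrow> j < n \<Longrightarrow> (\<Sum>k<n. u k i * u k j) = of_bool (i = j)"
    and "\<And>i k. i < n \<Longrightarrow> k < n \<Longrightarrow> (\<Sum>j<n. a i j * u k j) = l k * u k i"
    and "char_poly (mat n n (\<lambda>(i, j). a i j)) = (\<Prod>k<n. [:- l k, 1:])"
proof -
  define A where "A = mat n n (\<lambda>(i, j). a i j)"
  have A: "A \<in> carrier_mat n n" by (simp add: A_def)
  have "transpose_mat A = A" by (rule eq_matI) (auto simp: A_def sym)
  from symmetric_mat_orthogonal_diagonalization[OF A this] obtain P l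
    where P: "P \<in> carrier_mat n n" and PtP: "transpose_mat P * P = 1\<^sub>m n"
      and D: "transpose_mat P * A * P = mat_diag n l" by blast
  have Pt: "transpose_mat P \<in> carrier_mat n n" using P by simp
  have PPt: "P * transpose_mat P = 1\<^sub>m n" by (rule mat_mult_left_right_inverse[OF Pt P PtP])
  note assoc = assoc_mult_mat[of _ n n _ n _ n]
  have "A * P = (P * transpose_mat P) * A * P" using PPt A P by simp
  also have "\<dots> = P * (transpose_mat P * A * P)" using P Pt A by (simp add: assoc)
  finally have AP: "A * P = P * mat_diag n l" by (simp add: D)
  have "A = A * (P * transpose_mat P)" using PPt A by simp
  also have "\<dots> = P * mat_diag n l * transpose_mat P"
    using P Pt A AP by (simp add: assoc[symmetric])
  finally have "similar_mat A (mat_diag n l)"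
    using P Pt A PPt PtP
    by (intro similar_matI[of _ _ P "transpose_mat P" n]) auto
  then have "char_poly A = char_poly (mat_diag n l)" by (rule char_poly_similar)
  also have "\<dots> = (\<Prod>x\<leftarrow>diag_mat (mat_diag n l). [:- x, 1:])"
    by (rule char_poly_upper_triangular[of _ n]) (auto simp: mat_diag_def)
  also have "\<dots> = (\<Prod>k<n. [:- l k, 1:])"
    by (simp add: diag_mat_def mat_diag_def prod.list_conv_set_nth atLeast0LessThan)
  finally have cp: "char_poly A = (\<Prod>k<n. [:- l k, 1:])" .
  have "(\<Sum>i<n. (P $$ (i, k))\<^sup>2) = 1" if "k < n" for k
    using arg_cong[OF PtP, of "\<lambda>M. M $$ (k, k)"] P that
    by (simp add: scalar_prod_def power2_eq_square atLeast0LessThan)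
  moreover have "(\<Sum>k<n. P $$ (i, k) * P $$ (j, k)) = of_bool (i = j)" if "i < n" "j < n" for i j
    using arg_cong[OF PPt, of "\<lambda>M. M $$ (i, j)"] P that
    by (simp add: scalar_prod_def atLeast0LessThan)
  moreover have "(\<Sum>j<n. a i j * P $$ (j, k)) = l k * P $$ (i, k)" if "i < n" "k < n" for i k
    using arg_cong[OF AP, of "\<lambda>M. M $$ (i, k)"] P that
    by (simp add: mat_diag_mult_right[OF P])
      (simp add: A_def scalar_prod_def atLeast0LessThan mult.commute)
  ultimately show ?thesis
    using that[of "\<lambda>k i. P $$ (i, k)" l] cp by (simp add: A_def)
qed

section \<open>Eigenvalue estimates for nonnegative symmetric matrices\<close>

text \<open>All claims about \<open>l\<close> come from Parseval's identity in an eigenbasis. The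
  power sums are the traces of the square and the cube; the last two bounds test the matrix on the
  all-ones vector.\<close>

lemma nonneg_symmetric_spectrum:
  fixes a :: "nat \<Rightarrow> nat \<Rightarrow> real"
  assumes n: "n > 0"
    and sym: "\<And>i j. i < n \<Longrightarrow> j < n \<Longrightarrow> a i j = a j i"
    and nonneg: "\<And>i j. i < n \<Longrightarrow> j < n \<Longrightarrow> a i j \<ge> 0"
  obtains l :: "nat \<Rightarrow> real" and m where "m < n"
    and "char_poly (mat n n (\<lambda>(i, j). a i j)) = (\<Prod>k<n. [:- l k, 1:])"
    and "\<And>k. k < n \<Longrightarrow> \<bar>l k\<bar> \<le> l m"
    and "(\<Sum>k<n. (l k)\<^sup>2) = (\<Sum>i<n. \<Sum>j<n. (a i j)\<^sup>2)"
    and "(\<Sum>k<n. (l k) ^ 3) = (\<Sum>i<n. \<Sum>j<n. \<Sum>h<n. a i j * a j h * a h i)"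
    and "(\<Sum>i<n. \<Sum>j<n. a i j) \<le> l m * n"
    and "(\<Sum>i<n. (\<Sum>j<n. a i j)\<^sup>2) \<le> (l m)\<^sup>2 * n"
proof (rule symmetric_eigenbasis[of n a])
  show "a i j = a j i" if "i < n" "j < n" for i j using that by (rule sym)
next
  fix u :: "nat \<Rightarrow> nat \<Rightarrow> real" and l :: "nat \<Rightarrow> real"
  assume norm: "\<And>k. k < n \<Longrightarrow> (\<Sum>i<n. (u k i)\<^sup>2) = 1"
    and compl: "\<And>i j. i < n \<Longrightarrow> j < n \<Longrightarrow> (\<Sum>k<n. u k i * u k j) = of_bool (i = j)"
    and eig: "\<And>i k. i < n \<Longrightarrow> k < n \<Longrightarrow> (\<Sum>j<n. a i j * u k j) = l k * u k i"
    and cp: "char_poly (mat n n (\<lambda>(i, j). a i j)) = (\<Prod>k<n. [:- l k, 1:])"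
  \<comment> \<open>\<open>c x k\<close> is the coordinate of \<open>x\<close> along the eigenvector
    \<open>u k\<close>.\<close>
  define c where "c x k = (\<Sum>i<n. u k i * x i)" for x k
  have eig': "(\<Sum>i<n. u k i * a i j) = l k * u k j" if "j < n" "k < n" for j k
    using eig[OF that] sym that by (simp add: mult.commute)
  have expand: "x i = (\<Sum>k<n. c x k * u k i)" if "i < n" for x i
  proof -
    have "(\<Sum>k<n. c x k * u k i) = (\<Sum>k<n. \<Sum>j<n. x j * (u k j * u k i))"
      by (simp add: c_def sum_distrib_left sum_distrib_right mult_ac)
    also have "\<dots> = (\<Sum>j<n. \<Sum>k<n. x j * (u k j * u k i))" by (rule sum.swap)
    also have "\<dots> = (\<Sum>j<n. x j * of_bool (j = i))"
      using that by (simp add: sum_distrib_left[symmetric] compl)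
    also have "\<dots> = x i" using that by (simp add: of_bool_def if_distrib cong: if_cong)
    finally show ?thesis by simp
  qed
  have parseval: "(\<Sum>i<n. x i * y i) = (\<Sum>k<n. c x k * c y k)" for x y
  proof -
    have "(\<Sum>i<n. x i * y i) = (\<Sum>i<n. \<Sum>k<n. c x k * u k i * y i)"
      by (intro sum.cong refl, subst expand[of _ x]) (auto simp: sum_distrib_right)
    also have "\<dots> = (\<Sum>k<n. \<Sum>i<n. c x k * u k i * y i)" by (rule sum.swap)
    also have "\<dots> = (\<Sum>k<n. c x k * c y k)"
      by (simp add: c_def[of y] sum_distrib_left mult.assoc)
    finally show ?thesis .
  qed
  have c_apply: "c (\<lambda>i. \<Sum>j<n. a i j * x j) k = l k * c x k" if "k < n" for x k
  proof -
    have "c (\<lambda>i. \<Sum>j<n. a i j * x j) k = (\<Sum>i<n. \<Sum>j<n. u k i * a i j * x j)"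
      by (simp add: c_def sum_distrib_left mult.assoc)
    also have "\<dots> = (\<Sum>j<n. \<Sum>i<n. u k i * a i j * x j)" by (rule sum.swap)
    also have "\<dots> = (\<Sum>j<n. l k * u k j * x j)"
      using that by (simp add: sum_distrib_right[symmetric] eig')
    finally show ?thesis by (simp add: c_def sum_distrib_left mult.assoc)
  qed
  have c_row: "c (a i) k = l k * u k i" if "i < n" "k < n" for i k
    using eig[OF that] by (simp add: c_def mult.commute)
  have "Max (l ` {..<n}) \<in> l ` {..<n}" using n by (intro Max_in) auto
  then obtain m where m: "m < n" "l m = Max (l ` {..<n})" by auto
  have max: "l k \<le> l m" if "k < n" for k using that by (simp add: m(2))
  have rayleigh: "(\<Sum>i<n. x i * (\<Sum>j<n. a i j * x j)) \<le> l m * (\<Sum>i<n. (x i)\<^sup>2)" for x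
  proof -
    have "(\<Sum>i<n. x i * (\<Sum>j<n. a i j * x j)) = (\<Sum>k<n. l k * (c x k)\<^sup>2)"
      using parseval[of x "\<lambda>i. \<Sum>j<n. a i j * x j"] by (simp add: c_apply power2_eq_square mult.left_commute)
    also have "\<dots> \<le> (\<Sum>k<n. l m * (c x k)\<^sup>2)"
      by (intro sum_mono mult_right_mono) (auto simp: max)
    also have "\<dots> = l m * (\<Sum>i<n. (x i)\<^sup>2)"
      using parseval[of x x] by (simp add: sum_distrib_left power2_eq_square)
    finally show ?thesis .
  qed
  \<comment> \<open>Perron-Frobenius argument: taking absolute values of the entries of an
    eigenvector keeps its norm and, as \<open>a\<close> is nonnegative, gives a form at least |l k|,
    which the Rayleigh bound limits by \<open>l m\<close>.\<close>
  have abs: "\<bar>l k\<bar> \<le> l m" if k: "k < n" for k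
  proof -
    have "l k = (\<Sum>i<n. u k i * (\<Sum>j<n. a i j * u k j))"
      using norm[OF k] by (simp add: eig k power2_eq_square mult.left_commute sum_distrib_left[symmetric])
    also have "\<bar>\<dots>\<bar> \<le> (\<Sum>i<n. \<bar>u k i\<bar> * (\<Sum>j<n. a i j * \<bar>u k j\<bar>))"
      by (intro order.trans[OF sum_abs] sum_mono)
        (auto simp: abs_mult nonneg intro!: mult_left_mono order.trans[OF sum_abs] sum_mono)
    also have "\<dots> \<le> l m" using rayleigh[of "\<lambda>i. \<bar>u k i\<bar>"] norm[OF k] by simp
    finally show ?thesis .
  qed
  \<comment> \<open>Parseval for row \<open>a i\<close>, whose coordinates are
    \<open>l k * u k i\<close> by \<open>c_row\<close>.\<close>
  have "(\<Sum>j<n. (a i j)\<^sup>2) = (\<Sum>k<n. (l k)\<^sup>2 * (u k i)\<^sup>2)" if "i < n" for i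
    using parseval[of "a i" "a i"] that by (simp add: c_row power2_eq_square mult_ac)
  then have "(\<Sum>i<n. \<Sum>j<n. (a i j)\<^sup>2) = (\<Sum>i<n. \<Sum>k<n. (l k)\<^sup>2 * (u k i)\<^sup>2)" by simp
  also have "\<dots> = (\<Sum>k<n. \<Sum>i<n. (l k)\<^sup>2 * (u k i)\<^sup>2)" by (rule sum.swap)
  also have "\<dots> = (\<Sum>k<n. (l k)\<^sup>2)" by (simp add: sum_distrib_left[symmetric] norm)
  finally have sq: "(\<Sum>k<n. (l k)\<^sup>2) = (\<Sum>i<n. \<Sum>j<n. (a i j)\<^sup>2)" by simp
  \<comment> \<open>A diagonal entry of the cube is the inner product of row \<open>a i\<close> with
    its image under the matrix; their coordinates carry \<open>l k\<close> and its square.\<close>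
  have "(\<Sum>j<n. \<Sum>h<n. a i j * a j h * a h i) = (\<Sum>k<n. (l k) ^ 3 * (u k i)\<^sup>2)" if i: "i < n" for i
  proof -
    have "(\<Sum>j<n. \<Sum>h<n. a i j * a j h * a h i) = (\<Sum>j<n. a i j * (\<Sum>h<n. a j h * a i h))"
      using i by (simp add: sum_distrib_left mult.assoc sym)
    also have "\<dots> = (\<Sum>k<n. (l k) ^ 3 * (u k i)\<^sup>2)"
      using i parseval[of "a i" "\<lambda>j. \<Sum>h<n. a j h * a i h"]
      by (simp add: c_apply c_row) (simp add: power2_eq_square power3_eq_cube mult_ac)
    finally show ?thesis .
  qed
  then have "(\<Sum>i<n. \<Sum>j<n. \<Sum>h<n. a i j * a j h * a h i) = (\<Sum>i<n. \<Sum>k<n. (l k) ^ 3 * (u k i)\<^sup>2)"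
    by simp
  also have "\<dots> = (\<Sum>k<n. \<Sum>i<n. (l k) ^ 3 * (u k i)\<^sup>2)" by (rule sum.swap)
  also have "\<dots> = (\<Sum>k<n. (l k) ^ 3)" by (simp add: sum_distrib_left[symmetric] norm)
  finally have cube: "(\<Sum>k<n. (l k) ^ 3) = (\<Sum>i<n. \<Sum>j<n. \<Sum>h<n. a i j * a j h * a h i)" by simp
  have total: "(\<Sum>i<n. \<Sum>j<n. a i j) \<le> l m * n"
    using rayleigh[of "\<lambda>_. 1"] by simp
  \<comment> \<open>The row sums form the image of the all-ones vector, so their squared norm is at
    most the square of \<open>l m\<close> times \<open>n\<close>.\<close>
  have "(\<Sum>i<n. (\<Sum>j<n. a i j)\<^sup>2) = (\<Sum>k<n. (l k)\<^sup>2 * (c (\<lambda>_. 1) k)\<^sup>2)"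
    using parseval[of "\<lambda>i. \<Sum>j<n. a i j" "\<lambda>i. \<Sum>j<n. a i j"] c_apply[of _ "\<lambda>_. 1"]
    by (simp add: power2_eq_square mult_ac)
  also have "\<dots> \<le> (\<Sum>k<n. (l m)\<^sup>2 * (c (\<lambda>_. 1) k)\<^sup>2)"
    by (intro sum_mono mult_right_mono) (auto simp: abs_le_square_iff[symmetric] intro: order.trans[OF abs])
  also have "\<dots> = (l m)\<^sup>2 * n"
    using parseval[of "\<lambda>_. 1" "\<lambda>_. 1"] by (simp add: sum_distrib_left[symmetric] power2_eq_square)
  finally have deg: "(\<Sum>i<n. (\<Sum>j<n. a i j)\<^sup>2) \<le> (l m)\<^sup>2 * n" .
  show thesis by (rule that[of m l, OF m(1) cp _ sq cube total deg]) (rule abs)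
qed

section \<open>Turan's theorem and triangle counts\<close>

text \<open>Adjoining \<open>v\<close> to a clique among its neighbours gives a clique with one more
  vertex.\<close>

lemma clique_in_neighborhood:
  assumes sym: "symp E" and irrefl: "irreflp E"
    and fin: "finite S" and v: "v \<in> S"
    and cl: "\<forall>C\<subseteq>S. pairwise E C \<longrightarrow> card C \<le> Suc r"
    and C: "C \<subseteq> {u \<in> S. E v u}" "pairwise E C"
  shows "card C \<le> r"
proof -
  have "finite C" "v \<notin> C"
    using fin C(1) irrefl by (auto dest: finite_subset irreflpD)
  moreover have "insert v C \<subseteq> S" "pairwise E (insert v C)"
    using v C sym by (auto simp: pairwise_insert dest: sympD)
  then have "card (insert v C) \<le> Suc r" using cl by blast
  ultimately show ?thesis by simp
qed

text \<open>Induction on the clique bound, applied to the neighbourhood of a vertex \<open>v\<close>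
  of maximum degree. Vertices outside it have degree at most that of \<open>v\<close>, which
  controls the remaining pairs. Pairs are ordered, so each edge counts twice.\<close>

theorem turan_degree_sum:
  fixes E :: "'a \<Rightarrow> 'a \<Rightarrow> bool"
  assumes sym: "symp E" and irrefl: "irreflp E" and "finite S"
    and "\<forall>C\<subseteq>S. pairwise E C \<longrightarrow> card C \<le> Suc r"
  shows "(\<Sum>u\<in>S. \<Sum>v\<in>S. of_bool (E u v)) \<le> (1 - 1 / real (Suc r)) * (real (card S))\<^sup>2"
  using assms(3,4)
proof (induction r arbitrary: S)
  case 0
  \<comment> \<open>With clique bound 1 there are no edges at all, since an edge is a clique on two
    vertices.\<close>
  have "\<not> E u v" if "u \<in> S" "v \<in> S" for u v
  proof
    assume "E u v"
    then have "u \<noteq> v" "{u, v} \<subseteq> S" "pairwise E {u, v}"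
      using that sym irrefl by (auto simp: pairwise_insert dest: sympD irreflpD)
    then have "card {u, v} \<le> Suc 0" using "0.prems"(2) by blast
    with \<open>u \<noteq> v\<close> show False by simp
  qed
  then show ?case by simp
next
  case (Suc r)
  note fin = Suc.prems(1)
  show ?case
  proof (cases "S = {}")
    case False
    define d where "d u = (\<Sum>w\<in>S. of_bool (E u w) :: real)" for u
    have "Max (d ` S) \<in> d ` S" using fin False by (intro Max_in) auto
    then obtain v where v: "v \<in> S" "d v = Max (d ` S)" by auto
    then have max: "d u \<le> d v" if "u \<in> S" for u using fin that by simp
    define N where "N = {u \<in> S. E v u}"
    have N: "N \<subseteq> S" "finite N" using fin by (auto simp: N_def)
    have d_v: "d v = real (card N)"
      using fin by (simp add: d_def N_def sum.If_cases of_bool_def Int_def)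
    let ?e = "\<lambda>A B. \<Sum>u\<in>A. \<Sum>w\<in>B. of_bool (E u w) :: real"
    have IH: "?e N N \<le> (1 - 1 / real (Suc r)) * (d v)\<^sup>2"
      unfolding d_v
      using clique_in_neighborhood[OF sym irrefl fin v(1) Suc.prems(2)]
      by (intro Suc.IH[OF N(2)]) (simp add: N_def)
    have split: "?e A S = ?e A N + ?e A (S - N)" for A
      by (simp only: sum.subset_diff[OF N(1) fin] sum.distrib add.commute)
    have E_sym: "E x y \<longleftrightarrow> E y x" for x y using sym by (blast dest: sympD)
    \<comment> \<open>Reversing a pair from \<open>N\<close> to its complement gives a pair starting
      outside \<open>N\<close>, so the outer degree sum bounds these pairs too; hence the factor 2
      below.\<close>
    have "?e N (S - N) = ?e (S - N) N"
      by (subst sum.swap) (simp add: E_sym)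
    also have "\<dots> \<le> ?e (S - N) S"
      unfolding split by (simp add: sum_nonneg)
    finally have cross: "?e N (S - N) \<le> ?e (S - N) S" .
    have "?e (S - N) S \<le> (\<Sum>u\<in>S - N. d v)"
      unfolding d_def[symmetric] by (intro sum_mono max) auto
    also have "\<dots> = (real (card S) - d v) * d v"
      using N fin by (simp add: card_Diff_subset d_v of_nat_diff card_mono)
    finally have rest: "?e (S - N) S \<le> (real (card S) - d v) * d v" .
    have "?e S S = ?e (S - N) S + ?e N S"
      by (rule sum.subset_diff[OF N(1) fin])
    also have "\<dots> = ?e (S - N) S + ?e N N + ?e N (S - N)"
      by (simp only: split[of N] add.assoc)
    also have "\<dots> \<le> (1 - 1 / real (Suc r)) * (d v)\<^sup>2 + 2 * ((real (card S) - d v) * d v)"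
      using IH cross rest by linarith
    also have "\<dots> \<le> (1 - 1 / real (Suc (Suc r))) * (real (card S))\<^sup>2"
    proof -
      define k where "k = real (Suc r)"
      define x where "x = d v"
      define N where "N = real (card S)"
      have k: "k > 0" "real (Suc (Suc r)) = k + 1" by (auto simp: k_def)
      \<comment> \<open>The gap is a perfect square, vanishing at x = kN/(k+1), the degree in a
        balanced Turan graph. Here \<open>N\<close> is the order of \<open>S\<close>, no longer the
        neighbourhood.\<close>
      have "(1 - 1 / (k + 1)) * N\<^sup>2 - ((1 - 1 / k) * x\<^sup>2 + 2 * ((N - x) * x))
          = ((k + 1) * x - k * N)\<^sup>2 / (k * (k + 1))"
        using k by (simp add: field_simps) (simp add: power2_eq_square algebra_simps)
      also have "\<dots> \<ge> 0" using k by simp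
      finally show ?thesis unfolding k(2) k_def[symmetric] x_def[symmetric] N_def[symmetric] by simp
    qed
    finally show ?thesis .
  qed simp
qed

text \<open>For fixed \<open>u\<close>, the closed triples are the ordered adjacent pairs inside the
  neighbourhood of \<open>u\<close>. There the clique bound drops by one and Turan's theorem
  applies.\<close>

lemma triangle_sum_le:
  fixes E :: "'a \<Rightarrow> 'a \<Rightarrow> bool"
  assumes sym: "symp E" and irrefl: "irreflp E" and fin: "finite S"
    and cl: "\<forall>C\<subseteq>S. pairwise E C \<longrightarrow> card C \<le> Suc (Suc r)"
  shows "(\<Sum>u\<in>S. \<Sum>v\<in>S. \<Sum>w\<in>S. of_bool (E u v) * of_bool (E v w) * of_bool (E w u))
    \<le> (1 - 1 / real (Suc r)) * (\<Sum>u\<in>S. (\<Sum>v\<in>S. of_bool (E u v))\<^sup>2)"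
proof -
  have "(\<Sum>v\<in>S. \<Sum>w\<in>S. of_bool (E u v) * of_bool (E v w) * of_bool (E w u))
      \<le> (1 - 1 / real (Suc r)) * (\<Sum>v\<in>S. of_bool (E u v))\<^sup>2" if u: "u \<in> S" for u
  proof -
    define N where "N = {v \<in> S. E u v}"
    have N: "finite N" using fin by (simp add: N_def)
    have restrict: "(\<Sum>v\<in>S. of_bool (E u v) * f v) = sum f N" for f :: "'a \<Rightarrow> real"
      unfolding N_def using fin by (simp add: of_bool_def if_distrib[of "\<lambda>x. x * _"] sum.inter_filter cong: if_cong)
    have E_sym: "E w u \<longleftrightarrow> E u w" for w using sym by (blast dest: sympD)
    have "(\<Sum>v\<in>S. \<Sum>w\<in>S. of_bool (E u v) * of_bool (E v w) * of_bool (E w u) :: real)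
        = (\<Sum>v\<in>S. of_bool (E u v) * (\<Sum>w\<in>S. of_bool (E u w) * of_bool (E v w)))"
      by (simp add: sum_distrib_left E_sym mult_ac)
    also have "\<dots> = (\<Sum>v\<in>N. \<Sum>w\<in>N. of_bool (E v w))" by (simp only: restrict)
    also have "\<dots> \<le> (1 - 1 / real (Suc r)) * (real (card N))\<^sup>2"
      using clique_in_neighborhood[OF sym irrefl fin u cl]
      by (intro turan_degree_sum[OF sym irrefl N]) (simp add: N_def)
    also have "real (card N) = (\<Sum>v\<in>S. of_bool (E u v))"
      using restrict[of "\<lambda>_. 1"] by simp
    finally show ?thesis .
  qed
  then show ?thesis unfolding sum_distrib_left[of _ _ S] by (rule sum_mono)
qed

section \<open>The numerical inequalities\<close>

text \<open>Write r for \<open>l m\<close>. A positive eigenvalue adds its cube and a nonpositive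
  one x adds (r + x) x^2; all these are nonnegative, and index \<open>m\<close> alone adds
  r^3.\<close>

lemma positive_square_sum_le:
  fixes l :: "nat \<Rightarrow> real"
  assumes m: "m < n" and bound: "\<And>k. k < n \<Longrightarrow> \<bar>l k\<bar> \<le> l m" and pos: "l m > 0"
  shows "(\<Sum>k<n. if l k > 0 then (l k)\<^sup>2 else 0)
    \<le> (\<Sum>k<n. (l k)\<^sup>2) - (l m)\<^sup>2 + (\<Sum>k<n. (l k) ^ 3) / l m"
proof -
  let ?r = "l m"
  have "(\<Sum>k<n. if k = m then ?r ^ 3 else 0)
      \<le> (\<Sum>k<n. (l k) ^ 3 + ?r * ((l k)\<^sup>2 - (if l k > 0 then (l k)\<^sup>2 else 0)))"
  proof (rule sum_mono)
    fix k assume "k \<in> {..<n}"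
    then have "- l k \<le> ?r" using bound[of k] by simp
    then have "0 \<le> (?r + l k) * (l k)\<^sup>2" by (intro mult_nonneg_nonneg) auto
    then show "(if k = m then ?r ^ 3 else 0)
        \<le> (l k) ^ 3 + ?r * ((l k)\<^sup>2 - (if l k > 0 then (l k)\<^sup>2 else 0))"
      using pos by (auto simp: power2_eq_square power3_eq_cube algebra_simps)
  qed
  then have "?r ^ 3 \<le> (\<Sum>k<n. (l k) ^ 3)
      + ?r * ((\<Sum>k<n. (l k)\<^sup>2) - (\<Sum>k<n. if l k > 0 then (l k)\<^sup>2 else 0))"
    using m by (simp add: sum.distrib sum_distrib_left[symmetric] sum_subtractf)
  then show ?thesis
    using pos by (simp add: field_simps power2_eq_square power3_eq_cube)
qed

text \<open>The two bounds on \<open>e\<close> cross at r = \<open>t\<close>. With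
  \<open>r * N\<close> the bound on \<open>s\<close> increases in r up to \<open>t\<close>; with
  \<open>t * N\<close> it decreases beyond \<open>t\<close>. So r = \<open>t\<close> is the worst
  case.\<close>

lemma clique_number_bound_arith:
  fixes N w r e s :: real
  assumes w: "w \<ge> 2" and N: "N > 0" and r: "r > 0"
    and er: "e \<le> r * N" and ew: "e \<le> (1 - 1 / w) * N\<^sup>2"
    and s: "s \<le> e - r\<^sup>2 + (1 - 1 / (w - 1)) * (r * N)"
  shows "s \<le> N\<^sup>2 * (1 - 1 / w - 1 / w\<^sup>2)"
proof -
  define t where "t = (1 - 1 / w) * N"
  define c where "c = (1 - 1 / (w - 1)) * N"
  have ct: "c \<le> t"
    using w N by (auto simp: c_def t_def intro!: mult_right_mono divide_left_mono)
  \<comment> \<open>This places \<open>t\<close> left of the vertex (c + N)/2 of the first parabola;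
    it uses w >= 2.\<close>
  have c1: "c + N \<ge> 2 * t"
  proof -
    have "1 / w * 2 \<ge> 1 / (w - 1)" using w by (simp add: field_simps)
    then have "(1 - 1 / (w - 1) + 1 - 2 * (1 - 1 / w)) * N \<ge> 0"
      using N by (intro mult_nonneg_nonneg) auto
    then show ?thesis by (simp add: c_def t_def algebra_simps)
  qed
  \<comment> \<open>The common value of both bounds at r = \<open>t\<close> is the right-hand side
    sought.\<close>
  have t: "t * N - t\<^sup>2 + c * t = N\<^sup>2 * (1 - 1 / w - 1 / w\<^sup>2)"
    using w by (simp add: c_def t_def field_simps power2_eq_square)
  have s': "s \<le> e - r\<^sup>2 + c * r" using s by (simp add: c_def mult_ac)
  show ?thesis
  proof (cases "r \<le> t")
    case True
    have "(t - r) * (c + N - t - r) \<ge> 0" using True c1 by (intro mult_nonneg_nonneg) auto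
    then have "r * N - r\<^sup>2 + c * r \<le> t * N - t\<^sup>2 + c * t"
      by (simp add: power2_eq_square algebra_simps)
    then show ?thesis using s' er t by linarith
  next
    case False
    have t0: "t \<ge> 0" using w N by (simp add: t_def)
    have "(r - t) * (r + t - c) \<ge> 0" using False ct t0 r by (intro mult_nonneg_nonneg) auto
    then have "- (r\<^sup>2) + c * r \<le> - (t\<^sup>2) + c * t"
      by (simp add: power2_eq_square algebra_simps)
    moreover have "e \<le> t * N" using ew by (simp add: t_def power2_eq_square mult.assoc)
    ultimately show ?thesis using s' t by linarith
  qed
qed

section \<open>Application to the graph\<close>

lemma card_clique_le_clique_number:
  assumes "finite (pverts G)" "is_clique G C"
  shows "card C \<le> clique_number G"
proof -
  have "finite {C. is_clique G C}"
    by (rule finite_subset[of _ "Pow (pverts G)"]) (use assms in \<open>auto simp: is_clique_def\<close>)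
  then show ?thesis unfolding clique_number_def using assms by (intro Max_ge) auto
qed

text \<open>Without arcs the symmetric closure is empty, so a vertex reaches only itself,
  contradicting connectedness for two distinct vertices.\<close>

lemma connected_imp_arc:
  assumes "Digraph_Component.connected (with_proj G)" "card (pverts G) \<ge> 2"
  shows "\<exists>u v. (u, v) \<in> parcs G"
proof (rule ccontr)
  assume "\<not> ?thesis"
  then have "parcs (mk_symmetric (with_proj G)) = {}" by (auto simp: parcs_mk_symmetric)
  moreover obtain T where "T \<subseteq> pverts G" "card T = 2"
    using assms(2) by (metis obtain_subset_with_card_n)
  then obtain u v where uv: "u \<in> pverts G" "v \<in> pverts G" "u \<noteq> v"
    by (auto simp: card_2_iff)
  then have "u \<rightarrow>\<^sup>*\<^bsub>with_proj (mk_symmetric (with_proj G))\<^esub> v"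
    using assms(1) by (auto simp: connected_def strongly_connected_def)
  then have "(u, v) \<in> (parcs (mk_symmetric (with_proj G)))\<^sup>*"
    by (auto dest: reachable_rtranclI)
  ultimately show False using uv by simp
qed

text \<open>A splitting of the characteristic polynomial into linear factors lists the eigenvalues
  with multiplicity; neither the order of \<open>l\<close> nor the choice of \<open>vs\<close>
  matters.\<close>

lemma positive_square_energy_eq:
  fixes l :: "nat \<Rightarrow> real"
  assumes "distinct vs" "set vs = pverts G"
    and "char_poly (adjacency_matrix G vs) = (\<Prod>k<n. [:- l k, 1:])"
  shows "positive_square_energy G = (\<Sum>k<n. if l k > 0 then (l k)\<^sup>2 else 0)"
proof -
  have "proots (\<Prod>k<n. [:- l k, 1:]) = (\<Sum>k<n. {#l k#})"
    by (subst proots_prod) auto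
  also have "\<dots> = image_mset l (mset_set {..<n})"
    by (simp add: sum_unfold_sum_mset sum_mset_singleton_mset)
  finally have "adjacency_eigenvalues G = image_mset l (mset_set {..<n})"
    using assms adjacency_eigenvalues_eq by metis
  then have "positive_square_energy G = (\<Sum>k\<in>#filter_mset (\<lambda>k. l k > 0) (mset_set {..<n}). (l k)\<^sup>2)"
    by (simp add: positive_square_energy_def filter_mset_image_mset image_mset.compositionality comp_def)
  also have "\<dots> = (\<Sum>k | k < n \<and> l k > 0. (l k)\<^sup>2)"
    by (simp add: sum_unfold_sum_mset)
  also have "\<dots> = (\<Sum>k<n. if l k > 0 then (l k)\<^sup>2 else 0)"
    using sum.inter_filter[of "{..<n}" "\<lambda>k. (l k)\<^sup>2" "\<lambda>k. l k > 0"] by simp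
  finally show ?thesis .
qed

theorem theorem1p10:
  fixes G :: "'a pair_pre_digraph" and n \<omega> :: nat
  assumes "pair_graph G"
    and "Digraph_Component.connected (with_proj G)"
    and "n = card (pverts G)"
    and "\<omega> = clique_number G"
    and "n \<ge> 2"
  shows "sqrt (positive_square_energy G) \<le> real n * sqrt (1 - 1 / real \<omega> - 1 / (real \<omega>)\<^sup>2)"
proof -
  interpret pair_graph G by fact
  obtain u v where uv: "(u, v) \<in> parcs G" using connected_imp_arc assms by metis
  have symG: "(x, y) \<in> parcs G \<Longrightarrow> (y, x) \<in> parcs G" for x y
    by (simp add: arcs_symmetric)
  have no_loop: "(x, x) \<notin> parcs G" for x
    using no_loops[of "(x, x)"] by auto
  \<comment> \<open>An arc is a clique on two vertices, which keeps \<open>\<omega> - 1\<close>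
    positive.\<close>
  have "u \<noteq> v" "is_clique G {u, v}"
    using uv symG no_loop arc_fst_in_verts[OF uv] arc_snd_in_verts[OF uv]
    by (auto simp: is_clique_def)
  then have \<omega>: "\<omega> \<ge> 2"
    using card_clique_le_clique_number[of G "{u, v}"] pair_finite_verts assms(4) by simp
  obtain vs where vs: "distinct vs" "set vs = pverts G"
    using finite_distinct_list[OF pair_finite_verts] by blast
  have len: "length vs = n" using vs assms(3) distinct_card by metis
  \<comment> \<open>The graph is pulled back to indices. Symmetry and irreflexivity hold even out of
    range, as they are properties of \<open>parcs G\<close>.\<close>
  define E where "E i j \<longleftrightarrow> (vs ! i, vs ! j) \<in> parcs G" for i j
  define a :: "nat \<Rightarrow> nat \<Rightarrow> real" where "a i j = of_bool (E i j)" for i j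
  have adj: "adjacency_matrix G vs = mat n n (\<lambda>(i, j). a i j)"
    by (rule eq_matI) (auto simp: adjacency_matrix_def len a_def E_def)
  have E: "symp E" "irreflp E"
    by (auto simp: E_def symp_def irreflp_def no_loop intro: symG)
  have cl: "\<forall>C\<subseteq>{..<n}. pairwise E C \<longrightarrow> card C \<le> \<omega>"
  proof (intro allI impI)
    fix C assume C: "C \<subseteq> {..<n}" "pairwise E C"
    have "inj_on ((!) vs) C"
      using vs(1) C(1) len by (intro inj_on_nth) auto
    then have "card C = card ((!) vs ` C)" by (simp add: card_image)
    also have "is_clique G ((!) vs ` C)"
      using C(1)[THEN subsetD] C(2) len
      by (auto simp: is_clique_def pairwise_def E_def vs(2)[symmetric] intro!: nth_mem)
    then have "card ((!) vs ` C) \<le> \<omega>"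
      using card_clique_le_clique_number pair_finite_verts assms(4) by metis
    finally show "card C \<le> \<omega>" .
  qed
  have sym_a: "a i j = a j i" for i j
    using E(1) by (auto simp: a_def dest: sympD)
  have a_nonneg: "a i j \<ge> 0" for i j by (simp add: a_def)
  have n: "n > 0" using assms(5) by simp
  show ?thesis
  proof (rule nonneg_symmetric_spectrum[of n a])
    show "n > 0" by (fact n)
    show "a i j = a j i" for i j by (rule sym_a)
    show "a i j \<ge> 0" for i j by (rule a_nonneg)
  next
    fix l :: "nat \<Rightarrow> real" and m
    assume m: "m < n"
      and cp: "char_poly (mat n n (\<lambda>(i, j). a i j)) = (\<Prod>k<n. [:- l k, 1:])"
      and bound: "\<And>k. k < n \<Longrightarrow> \<bar>l k\<bar> \<le> l m"
      and sq: "(\<Sum>k<n. (l k)\<^sup>2) = (\<Sum>i<n. \<Sum>j<n. (a i j)\<^sup>2)"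
      and cube: "(\<Sum>k<n. (l k) ^ 3) = (\<Sum>i<n. \<Sum>j<n. \<Sum>h<n. a i j * a j h * a h i)"
      and total: "(\<Sum>i<n. \<Sum>j<n. a i j) \<le> l m * n"
      and deg: "(\<Sum>i<n. (\<Sum>j<n. a i j)\<^sup>2) \<le> (l m)\<^sup>2 * n"
    let ?e = "\<Sum>i<n. \<Sum>j<n. a i j" and ?r = "l m"
    \<comment> \<open>The arc gives an entry 1, so the degree sum is positive and hence so is the
      largest eigenvalue, by which the proof divides.\<close>
    have "u \<in> set vs" "v \<in> set vs"
      using arc_fst_in_verts[OF uv] arc_snd_in_verts[OF uv] vs(2) by auto
    then obtain i j where "i < n" "vs ! i = u" "j < n" "vs ! j = v"
      using len by (auto simp: in_set_conv_nth)
    then have ij: "i < n" "j < n" "a i j = 1" using uv by (auto simp: a_def E_def)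
    have row: "0 < (\<Sum>j<n. a i j)"
      by (rule sum_pos2[of _ j]) (use ij in \<open>auto simp: a_def\<close>)
    have "0 < ?e"
      by (rule sum_pos2[of _ i]) (use ij(1) row in \<open>auto simp: a_nonneg sum_nonneg\<close>)
    then have "0 < ?r * n" using total by simp
    then have r: "?r > 0" using n by (simp add: zero_less_mult_iff)
    \<comment> \<open>Turan's theorem is used with \<open>r = Suc p\<close>, the triangle bound with
      \<open>r = p\<close>.\<close>
    obtain p where p: "\<omega> = Suc (Suc p)" using \<omega> by (metis add_2_eq_Suc le_Suc_ex)
    have "?e \<le> (1 - 1 / real \<omega>) * (real n)\<^sup>2"
      unfolding a_def p using turan_degree_sum[OF E finite_lessThan cl[unfolded p]]
      by (simp only: card_lessThan)
    moreover have "(\<Sum>k<n. (l k) ^ 3) / ?r \<le> (1 - 1 / (real \<omega> - 1)) * (?r * n)"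
    proof -
      have "(\<Sum>k<n. (l k) ^ 3) \<le> (1 - 1 / real (Suc p)) * (\<Sum>i<n. (\<Sum>j<n. a i j)\<^sup>2)"
        unfolding cube a_def by (rule triangle_sum_le[OF E finite_lessThan cl[unfolded p]])
      also have "real (Suc p) = real \<omega> - 1" by (simp add: p)
      also have "(1 - 1 / (real \<omega> - 1)) * (\<Sum>i<n. (\<Sum>j<n. a i j)\<^sup>2)
          \<le> (1 - 1 / (real \<omega> - 1)) * (?r\<^sup>2 * n)"
        using \<omega> by (intro mult_left_mono deg) simp
      finally show ?thesis using r by (simp add: pos_divide_le_eq power2_eq_square mult_ac)
    qed
    \<comment> \<open>Entries are 0 or 1, so the sum of squared eigenvalues is the degree
      sum.\<close>
    moreover have "(a i j)\<^sup>2 = a i j" for i j by (simp add: a_def of_bool_def)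
    then have "(\<Sum>k<n. (l k)\<^sup>2) = ?e" unfolding sq by simp
    moreover have "(\<Sum>k<n. if l k > 0 then (l k)\<^sup>2 else 0)
        \<le> (\<Sum>k<n. (l k)\<^sup>2) - ?r\<^sup>2 + (\<Sum>k<n. (l k) ^ 3) / ?r"
      by (rule positive_square_sum_le[where l = l, OF m _ r]) (rule bound)
    ultimately have "positive_square_energy G
        \<le> (real n)\<^sup>2 * (1 - 1 / real \<omega> - 1 / (real \<omega>)\<^sup>2)"
      using total r n \<omega> unfolding positive_square_energy_eq[OF vs cp[folded adj]]
      by (intro clique_number_bound_arith[of _ _ ?r ?e]) auto
    then have "sqrt (positive_square_energy G)
        \<le> sqrt ((real n)\<^sup>2 * (1 - 1 / real \<omega> - 1 / (real \<omega>)\<^sup>2))"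
      by (rule real_sqrt_le_mono)
    then show ?thesis by (simp add: real_sqrt_mult)
  qed
qed

end
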